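(* There exists an absolute constant $c>0$ such that the following holds. Let $M\ge 2$, $n\ge 1$ be integers and let $b,R,L>0$ be real numbers. Let $Q(\theta)=\theta^T\Sigma\theta$ for $\theta\in\mathbb{R}^M$, where $\Sigma=(\Sigma_{jj'})$ is a positive semi-definite $M\times M$ matrix. Let $Z_1,\dots,Z_n$ be i.i.d. random variables valued in a measurable space $\mathcal{Z}$, let $h_1,\dots,h_M:\mathcal{Z}\to\mathbb{R}$ be measurable functions and let $h_\theta=\sum_{j=1}^M\theta_jh_j$ for all $\theta=(\theta_1,\dots,\theta_M)^T\in\mathbb{R}^M$. Assume that $$|h_j(Z_1)|\le b\ \text{ almost surely},\qquad \Sigma_{jj}\le R^2,\qquad \mathbb{E}[h_\theta^2(Z_1)]\le L\,Q(\theta)$$ for all $j=1,\dots,M$ and all $\theta\in\Lambda^M$. Then for all $r>0$ such that $R/\sqrt M\le r\le R$, $$\mathbb{E}\left[\sup_{\theta\in\Lambda^M:\ Q(\theta)\le r^2}F(\theta)\right]\le c\,\max\left(\sqrt L\,R\sqrt{\frac{\log(eMr^2/R^2)}{n}},\ \frac{bR^2\log(eMr^2/R^2)}{r^2n}\right),$$ where $F(\theta)=\frac1n\left|\sum_{i=1}^n\epsilon_ih_\theta(Z_i)\right|$ for all $\theta\in\mathbb{R}^M$.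
   Context: $\Lambda^M=\{\theta\in\mathbb{R}^M:\ \sum_{j=1}^M\theta_j=1,\ \theta_j\ge 0\text{ for all }j\}$ is the simplex. $\epsilon_1,\dots,\epsilon_n$ are i.i.d. Rademacher random variables (uniform on $\{-1,1\}$) independent of all other random variables. A supremum of a nonnegative function over an empty set is $0$. *)

theory Defs
  imports "HOL-Probability.Probability"
begin

text \<open>
  The dimension \<open>M\<close> is quantified inside statements, so vectors in \<open>\<real>\<^sup>M\<close> are functions
  on \<open>nat\<close> of which only the values on \<open>{1..M}\<close> matter, and matrices are functions of two indices.
\<close>

definition prob_simplex :: "nat \<Rightarrow> (nat \<Rightarrow> real) set" where
  "prob_simplex M = {\<theta> \<in> {1..M} \<rightarrow>\<^sub>E UNIV. (\<Sum>j=1..M. \<theta> j) = 1 \<and> (\<forall>j\<in>{1..M}. 0 \<le> \<theta> j)}"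

definition quad_form :: "nat \<Rightarrow> (nat \<Rightarrow> nat \<Rightarrow> real) \<Rightarrow> (nat \<Rightarrow> real) \<Rightarrow> real" where
  "quad_form M A \<theta> = (\<Sum>j=1..M. \<Sum>k=1..M. \<theta> j * A j k * \<theta> k)"

definition pos_semidef :: "nat \<Rightarrow> (nat \<Rightarrow> nat \<Rightarrow> real) \<Rightarrow> bool" where
  "pos_semidef M A \<longleftrightarrow>
     (\<forall>j\<in>{1..M}. \<forall>k\<in>{1..M}. A j k = A k j) \<and> (\<forall>\<theta>. 0 \<le> quad_form M A \<theta>)"

definition lin_comb :: "nat \<Rightarrow> (nat \<Rightarrow> 'z \<Rightarrow> real) \<Rightarrow> (nat \<Rightarrow> real) \<Rightarrow> 'z \<Rightarrow> real" where
  "lin_comb M h \<theta> z = (\<Sum>j=1..M. \<theta> j * h j z)"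

definition iid :: "'w measure \<Rightarrow> 's measure \<Rightarrow> nat \<Rightarrow> (nat \<Rightarrow> 'w \<Rightarrow> 's) \<Rightarrow> bool" where
  "iid P S n X \<longleftrightarrow>
     prob_space.indep_vars P (\<lambda>_. S) X {1..n} \<and>
     (\<forall>i\<in>{1..n}. \<forall>k\<in>{1..n}. distr P S (X i) = distr P S (X k))"

definition rademacher :: "'w measure \<Rightarrow> ('w \<Rightarrow> real) \<Rightarrow> bool" where
  "rademacher P X \<longleftrightarrow> X \<in> borel_measurable P \<and>
     measure P {\<omega> \<in> space P. X \<omega> = 1} = 1/2 \<and>
     measure P {\<omega> \<in> space P. X \<omega> = -1} = 1/2"

text \<open>
  Independence of two random elements with values in possibly different types; the
  library's \<open>indep_var\<close> requires both to have the same type of values.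
\<close>

definition indep_rv ::
  "'w measure \<Rightarrow> 's measure \<Rightarrow> ('w \<Rightarrow> 's) \<Rightarrow> 't measure \<Rightarrow> ('w \<Rightarrow> 't) \<Rightarrow> bool" where
  "indep_rv P S X T Y \<longleftrightarrow> X \<in> P \<rightarrow>\<^sub>M S \<and> Y \<in> P \<rightarrow>\<^sub>M T \<and>
     prob_space.indep_set P {X -` A \<inter> space P |A. A \<in> sets S} {Y -` B \<inter> space P |B. B \<in> sets T}"

definition rademacher_process ::
  "nat \<Rightarrow> nat \<Rightarrow> (nat \<Rightarrow> 'w \<Rightarrow> real) \<Rightarrow> (nat \<Rightarrow> 'w \<Rightarrow> 'z) \<Rightarrow> (nat \<Rightarrow> 'z \<Rightarrow> real) \<Rightarrow>
     (nat \<Rightarrow> real) \<Rightarrow> 'w \<Rightarrow> real" where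
  "rademacher_process M n \<epsilon> Z h \<theta> \<omega> =
     1 / real n * \<bar>\<Sum>i=1..n. \<epsilon> i \<omega> * lin_comb M h \<theta> (Z i \<omega>)\<bar>"

end

theory Submission
  imports Defs
begin

text \<open>
  The supremum runs over an infinite set, but on the scale \<open>Q(\<theta>) \<le> r\<^sup>2\<close> the points of the simplex can be
  replaced by barycentres of few vertices. This is Maurey's argument: let \<open>u\<close> be the barycentre of \<open>m\<close> vertices drawn independently with
  probabilities \<open>\<theta>\<close>. Its mean is \<open>\<theta>\<close>, and the mean of \<open>Q(u)\<close> is at most \<open>Q(\<theta>) + R\<^sup>2/m\<close>. Hence for every
  linear functional \<open>g\<close> and every \<open>a \<ge> 0\<close> some such \<open>u\<close> satisfies
  \<open>g(\<theta>) - a (Q(\<theta>) + R\<^sup>2/m) \<le> g(u) - a Q(u)\<close> (lemma \<open>sparse_approximation\<close>). For the integer part \<open>m\<close> of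
  \<open>R\<^sup>2/r\<^sup>2\<close> the price paid on the left is at most \<open>3 a r\<^sup>2\<close>, and the number of barycentres is at most
  \<open>(2eM/m)\<^sup>m\<close>. Its logarithm is of the order of \<open>D = (R\<^sup>2/r\<^sup>2) log(eMr\<^sup>2/R\<^sup>2)\<close>
  (lemma \<open>double_card_compositions_le_exp\<close>).

  It remains to bound the expected maximum of \<open>\<plusminus> G(u) - a Q(u)\<close> over the barycentres, where \<open>G(u)\<close> is
  the Rademacher average of \<open>h\<^sub>u\<close>. Averaging over a sign turns \<open>exp(\<epsilon> x)\<close> into \<open>cosh x\<close>, which is at most
  \<open>1 + x\<^sup>2\<close> for \<open>\<bar>x\<bar> \<le> 1\<close>. So for \<open>\<gamma> \<le> n/b\<close> the exponential moment of \<open>\<gamma> G(u)\<close> is at most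
  \<open>exp(\<gamma>\<^sup>2 L Q(u)/n)\<close>. The penalty with \<open>a = \<gamma> L/n\<close> cancels exactly this factor, whatever the size of
  \<open>Q(u)\<close> (lemma \<open>exp_weight_moment_le_1\<close>). All barycentres are thus treated alike, and the
  maximum has expectation at most \<open>4D/\<gamma>\<close>. The resulting bound \<open>3 \<gamma> L r\<^sup>2/n + 4D/\<gamma>\<close> is balanced by
  the choice of \<open>\<gamma>\<close> in lemma \<open>optimal_scale\<close>: the square-root term is the unconstrained optimum, the
  other term comes from the constraint \<open>\<gamma> \<le> n/b\<close>.
\<close>

section \<open>Counting compositions\<close>

text \<open>
  The vectors of multiplicities of \<open>m\<close> vertices of the simplex chosen with repetition. Fixing the
  values outside \<open>{1..M}\<close> makes the set finite.
\<close>

definition compositions :: "nat \<Rightarrow> nat \<Rightarrow> (nat \<Rightarrow> nat) set" where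
  "compositions M m = {c \<in> {1..M} \<rightarrow>\<^sub>E UNIV. (\<Sum>j=1..M. c j) = m}"

lemma compositions_inject_lists:
  fixes M :: nat
  defines "f \<equiv> (\<lambda>c::nat \<Rightarrow> nat. map c [1..<Suc M])"
  shows "inj_on f (compositions M m)"
    and "f ` compositions M m \<subseteq> {l. length l = M \<and> sum_list l = m}"
proof -
  show "inj_on f (compositions M m)"
  proof (rule inj_onI)
    fix c d assume cd: "c \<in> compositions M m" "d \<in> compositions M m" and "f c = f d"
    then have "\<forall>j\<in>{1..M}. c j = d j"
      by (simp add: f_def atLeastLessThanSuc_atLeastAtMost del: upt_Suc)
    with cd show "c = d"
      by (intro PiE_ext[of c "{1..M}" "\<lambda>_. UNIV" d]) (auto simp: compositions_def)
  qed
  have "sum_list (map c [1..<Suc M]) = (\<Sum>j=1..M. c j)" for c :: "nat \<Rightarrow> nat"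
    by (simp only: interv_sum_list_conv_sum_set_nat set_upt atLeastLessThanSuc_atLeastAtMost)
  then show "f ` compositions M m \<subseteq> {l. length l = M \<and> sum_list l = m}"
    by (auto simp: f_def compositions_def simp del: upt_Suc)
qed

lemma finite_lists_fixed_sum: "finite {l::nat list. length l = M \<and> sum_list l = m}"
proof (rule finite_subset)
  show "{l::nat list. length l = M \<and> sum_list l = m} \<subseteq> {l. set l \<subseteq> {..m} \<and> length l = M}"
    using member_le_sum_list by fastforce
qed (auto intro: finite_lists_length_eq)

lemma finite_compositions: "finite (compositions M m)"
  using finite_subset[OF compositions_inject_lists(2) finite_lists_fixed_sum]
    finite_imageD[OF _ compositions_inject_lists(1)] by blast

text \<open>
  Stars and bars give at most \<open>(2M)\<^sup>m / m!\<close> compositions. The factorial is essential: the \<open>M\<^sup>m\<close> ordered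
  choices would lead to \<open>log M\<close> in place of \<open>log (M/m)\<close>.
\<close>

lemma card_compositions_le:
  assumes "1 \<le> m" "m \<le> M"
  shows "real (card (compositions M m)) \<le> (2 * exp 1 * real M / real m) ^ m"
proof -
  have "card (compositions M m) \<le> card {l::nat list. length l = M \<and> sum_list l = m}"
    by (rule card_inj_on_le[OF compositions_inject_lists finite_lists_fixed_sum])
  then have "card (compositions M m) \<le> (m + M - 1) choose m"
    by (simp add: card_length_sum_list)
  then have "card (compositions M m) * fact m \<le> (m + M - 1) ^ m"
    using binomial_fact_pow[of "m + M - 1" m] by (meson le_trans mult_le_mono1)
  also have "\<dots> \<le> (2 * M) ^ m"
    using assms by (intro power_mono) auto
  finally have "real (card (compositions M m) * fact m) \<le> real ((2 * M) ^ m)"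
    using of_nat_le_iff by blast
  then have *: "real (card (compositions M m)) * fact m \<le> (2 * real M) ^ m"
    by simp
  \<comment> \<open>the Stirling-type bound \<open>m ^ m / m! \<le> e ^ m\<close> is one term of the exponential series\<close>
  have "(\<Sum>k\<in>{m}. real m ^ k /\<^sub>R fact k) \<le> exp (real m)"
    unfolding exp_def by (rule sum_le_suminf[OF summable_exp_generic]) auto
  then have fact_ge: "real m ^ m \<le> exp 1 ^ m * fact m"
    by (simp add: field_simps exp_of_nat_mult[symmetric])
  have "real (card (compositions M m)) * real m ^ m \<le> real (card (compositions M m)) * (exp 1 ^ m * fact m)"
    by (intro mult_left_mono fact_ge) auto
  also have "\<dots> \<le> exp 1 ^ m * (2 * real M) ^ m"
    using mult_left_mono[OF *, of "exp 1 ^ m"] by (simp add: mult_ac)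
  finally show ?thesis
    using assms by (simp add: power_divide power_mult_distrib field_simps)
qed

text \<open>
  The entropy bound for the integer part of \<open>T\<close>, which lies between \<open>T/2\<close> and \<open>T\<close>. The logarithm on
  the right is at least \<open>1\<close>, so that it absorbs the numerical constants; the factor \<open>2\<close> on the left
  leaves room for the two signs of the process.
\<close>

lemma double_card_compositions_le_exp:
  fixes T :: real
  assumes "1 \<le> T" "T \<le> real M"
  shows "2 * real (card (compositions M (nat \<lfloor>T\<rfloor>))) \<le> exp (4 * (T * ln (exp 1 * real M / T)))"
proof -
  define m where "m = nat \<lfloor>T\<rfloor>"
  define l where "l = ln (exp 1 * real M / T)"
  have m: "1 \<le> m" "real m \<le> T"
    using assms unfolding m_def by linarith+
  moreover have "T < real m + 1"
    using assms unfolding m_def by linarith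
  ultimately have m2: "T \<le> 2 * real m" by linarith
  have "m \<le> M" using m(2) assms(2) by linarith
  have "l \<ge> 1"
    unfolding l_def using assms by (subst ln_ge_iff) (auto simp: field_simps)
  have ln2: "ln (2::real) \<le> 1" using ln_le_minus_one[of 2] by simp
  have pos: "exp 1 * real M / T > 0" using assms by auto
  have "2 * real (card (compositions M m)) \<le> 2 * (2 * exp 1 * real M / real m) ^ m"
    using card_compositions_le[OF m(1) \<open>m \<le> M\<close>] by simp
  also have "\<dots> \<le> 2 * (4 * (exp 1 * real M / T)) ^ m"
  proof -
    have "2 * exp 1 * real M / real m \<le> 4 * (exp 1 * real M / T)"
      using m m2 assms by (simp add: field_simps)
    then show ?thesis by (simp add: power_mono)
  qed
  also have "\<dots> = exp (ln 2 + real m * (2 * ln 2 + l))"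
  proof -
    have "ln (4::real) = 2 * ln 2" using ln_realpow[of 2 2] by simp
    then have "4 * (exp 1 * real M / T) = exp (2 * ln 2 + l)"
      using pos by (simp add: l_def exp_add exp_double power2_eq_square)
    then show ?thesis by (simp add: exp_add exp_of_nat_mult)
  qed
  also have "\<dots> \<le> exp (4 * (T * l))"
  proof -
    have "real m * (2 * ln 2 + l) \<le> T * (2 * ln 2 + l)"
      using m \<open>l \<ge> 1\<close> by (intro mult_right_mono) auto
    moreover have "T * (2 * ln 2) \<le> T * 2" using ln2 assms by (intro mult_left_mono) auto
    moreover have "T \<le> T * l" using \<open>l \<ge> 1\<close> assms mult_left_mono[of 1 l T] by simp
    ultimately have "ln 2 + real m * (2 * ln 2 + l) \<le> 4 * (T * l)"
      using ln2 assms(1) distrib_left[of T "2 * ln 2" l] by linarith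
    then show ?thesis by simp
  qed
  finally show ?thesis unfolding m_def l_def .
qed

section \<open>Sparse approximation in the simplex\<close>

definition bilin_form :: "nat \<Rightarrow> (nat \<Rightarrow> nat \<Rightarrow> real) \<Rightarrow> (nat \<Rightarrow> real) \<Rightarrow> (nat \<Rightarrow> real) \<Rightarrow> real" where
  "bilin_form M A v w = (\<Sum>j=1..M. \<Sum>k=1..M. v j * A j k * w k)"

lemma quad_form_bilin: "quad_form M A v = bilin_form M A v v"
  by (simp add: quad_form_def bilin_form_def)

lemma bilin_form_linear_right: "bilin_form M A v w = (\<Sum>k=1..M. w k * (\<Sum>j=1..M. v j * A j k))"
  unfolding bilin_form_def sum_distrib_left by (subst sum.swap) (simp add: mult_ac)

lemma bilin_form_commute:
  assumes "pos_semidef M A"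
  shows "bilin_form M A v w = bilin_form M A w v"
proof -
  have "bilin_form M A v w = (\<Sum>k=1..M. \<Sum>j=1..M. v j * A j k * w k)"
    unfolding bilin_form_def by (rule sum.swap)
  also have "\<dots> = bilin_form M A w v"
    unfolding bilin_form_def using assms
    by (intro sum.cong refl) (auto simp: pos_semidef_def)
  finally show ?thesis .
qed

lemma bilin_form_add_right: "bilin_form M A v (\<lambda>j. w j + x j) = bilin_form M A v w + bilin_form M A v x"
  by (simp add: bilin_form_linear_right distrib_right sum.distrib)

lemma bilin_form_scale_right: "bilin_form M A v (\<lambda>j. s * w j) = s * bilin_form M A v w"
  by (simp add: bilin_form_linear_right sum_distrib_left mult_ac)

lemma quad_form_add:
  assumes "pos_semidef M A"
  shows "quad_form M A (\<lambda>j. v j + w j) = quad_form M A v + 2 * bilin_form M A v w + quad_form M A w"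
  by (simp add: quad_form_bilin bilin_form_add_right bilin_form_commute[OF assms, of "\<lambda>j. v j + w j"]
      bilin_form_commute[OF assms, of w v])

lemma quad_form_scale:
  assumes "pos_semidef M A"
  shows "quad_form M A (\<lambda>j. s * v j) = s\<^sup>2 * quad_form M A v"
  by (simp add: quad_form_bilin bilin_form_scale_right bilin_form_commute[OF assms, of "\<lambda>j. s * v j"]
      power2_eq_square)

lemma quad_form_cong:
  assumes "\<And>j. j \<in> {1..M} \<Longrightarrow> v j = w j"
  shows "quad_form M A v = quad_form M A w"
  unfolding quad_form_def by (intro sum.cong refl) (simp add: assms)

text \<open>
  For a probability vector \<open>\<theta>\<close>: the displacement from \<open>\<theta>\<close> to a random vertex drawn with
  probabilities \<open>\<theta>\<close> is centred.
\<close>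

lemma mean_linear_increment:
  fixes x :: "nat \<Rightarrow> real"
  assumes "(\<Sum>i=1..M. \<theta> i) = 1"
  shows "(\<Sum>i=1..M. \<theta> i * (\<Sum>j=1..M. ((if j = i then 1 else 0) - \<theta> j) * x j)) = 0"
proof -
  have "(\<Sum>j=1..M. ((if j = i then 1 else 0) - \<theta> j) * x j) = x i - (\<Sum>j=1..M. \<theta> j * x j)"
    if "i \<in> {1..M}" for i
  proof -
    have "(\<Sum>j=1..M. (if j = i then 1 else 0) * x j) = (\<Sum>j=1..M. if j = i then x j else 0)"
      by (intro sum.cong) auto
    also have "\<dots> = x i" using that by simp
    finally show ?thesis by (simp add: left_diff_distrib sum_subtractf)
  qed
  then have "(\<Sum>i=1..M. \<theta> i * (\<Sum>j=1..M. ((if j = i then 1 else 0) - \<theta> j) * x j))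
      = (\<Sum>i=1..M. \<theta> i * (x i - (\<Sum>j=1..M. \<theta> j * x j)))" by simp
  also have "\<dots> = 0"
    using assms by (simp only: right_diff_distrib sum_subtractf sum_distrib_right[symmetric] mult_1_left diff_self)
  finally show ?thesis .
qed

text \<open>
  For a probability vector \<open>\<theta>\<close> this is the variance formula, in the seminorm of \<open>A\<close>, for a random
  vertex drawn with probabilities \<open>\<theta>\<close>.
\<close>

lemma mean_quad_increment:
  assumes A: "pos_semidef M A" and \<theta>: "(\<Sum>i=1..M. \<theta> i) = 1"
  shows "(\<Sum>i=1..M. \<theta> i * quad_form M A (\<lambda>j. (if j = i then 1 else 0) - \<theta> j))
      = (\<Sum>i=1..M. \<theta> i * A i i) - quad_form M A \<theta>"
proof -
  let ?e = "\<lambda>i j. if j = i then 1 else (0::real)"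
  have e: "bilin_form M A w (?e i) = (\<Sum>j=1..M. w j * A j i)" if "i \<in> {1..M}" for i w
  proof -
    have "bilin_form M A w (?e i) = (\<Sum>k=1..M. if k = i then (\<Sum>j=1..M. w j * A j k) else 0)"
      unfolding bilin_form_linear_right by (intro sum.cong) auto
    then show ?thesis using that by simp
  qed
  have ee: "quad_form M A (?e i) = A i i" if "i \<in> {1..M}" for i
  proof -
    have "quad_form M A (?e i) = (\<Sum>j=1..M. if j = i then A j i else 0)"
      unfolding quad_form_bilin e[OF that] by (intro sum.cong) auto
    then show ?thesis using that by simp
  qed
  have "quad_form M A (\<lambda>j. ?e i j - \<theta> j) = A i i - 2 * (\<Sum>j=1..M. \<theta> j * A j i) + quad_form M A \<theta>"
    if "i \<in> {1..M}" for i
  proof -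
    have "quad_form M A (\<lambda>j. (-1) * \<theta> j + ?e i j)
        = quad_form M A \<theta> + 2 * bilin_form M A (\<lambda>j. (-1) * \<theta> j) (?e i) + A i i"
      by (simp only: quad_form_add[OF A] quad_form_scale[OF A] ee[OF that]) simp
    also have "bilin_form M A (\<lambda>j. (-1) * \<theta> j) (?e i) = - (\<Sum>j=1..M. \<theta> j * A j i)"
      using e[OF that] by (simp add: sum_negf)
    finally show ?thesis by simp
  qed
  then have "(\<Sum>i=1..M. \<theta> i * quad_form M A (\<lambda>j. ?e i j - \<theta> j))
      = (\<Sum>i=1..M. \<theta> i * A i i - 2 * (\<theta> i * (\<Sum>j=1..M. \<theta> j * A j i)) + \<theta> i * quad_form M A \<theta>)"
    by (intro sum.cong refl) (simp only: distrib_left right_diff_distrib mult.left_commute)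
  also have "\<dots> = (\<Sum>i=1..M. \<theta> i * A i i) - 2 * bilin_form M A \<theta> \<theta> + (\<Sum>i=1..M. \<theta> i) * quad_form M A \<theta>"
    by (simp only: sum.distrib sum_subtractf sum_distrib_left[symmetric] sum_distrib_right[symmetric]
        bilin_form_linear_right)
  finally show ?thesis using \<theta> by (simp add: quad_form_bilin)
qed

lemma exists_ge_weighted_mean:
  fixes f :: "nat \<Rightarrow> real"
  assumes "(\<Sum>i=1..M. \<theta> i) = 1" "\<And>i. i \<in> {1..M} \<Longrightarrow> 0 \<le> \<theta> i"
  shows "\<exists>i\<in>{1..M}. (\<Sum>i=1..M. \<theta> i * f i) \<le> f i"
proof (rule ccontr)
  assume neg: "\<not> ?thesis"
  define S where "S = (\<Sum>i=1..M. \<theta> i * f i)"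
  have lt: "f i < S" if "i \<in> {1..M}" for i using neg that S_def by force
  obtain k where k: "k \<in> {1..M}" "\<theta> k \<noteq> 0"
    using assms(1) by (metis sum.neutral zero_neq_one)
  have "(\<Sum>i=1..M. \<theta> i * f i) < (\<Sum>i=1..M. \<theta> i * S)"
  proof (rule sum_strict_mono_ex1)
    show "\<forall>i\<in>{1..M}. \<theta> i * f i \<le> \<theta> i * S"
      using lt assms(2) by (intro ballI mult_left_mono) (auto simp: less_imp_le)
    have "0 < \<theta> k" using k assms(2)[of k] by simp
    then show "\<exists>i\<in>{1..M}. \<theta> i * f i < \<theta> i * S"
      using lt k(1) by (intro bexI[of _ k]) auto
  qed simp
  then show False using assms(1) by (simp only: sum_distrib_right[symmetric] S_def[symmetric] mult_1_left)
qed

text \<open>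
  Maurey's argument by the method of conditional expectations. The \<open>k\<close> vertices are selected one
  after the other, each at least as good as its average under the weights \<open>\<theta>\<close>. As the displacement is
  centred, a step changes the linear part by \<open>0\<close> and the quadratic form by the variance of one vertex,
  on average. This replaces the independent random vertices by an induction.
\<close>

lemma greedy_composition:
  assumes A: "pos_semidef M A" and \<theta>: "\<theta> \<in> prob_simplex M"
  shows "\<exists>c\<in>compositions M k.
    - a * real k * ((\<Sum>i=1..M. \<theta> i * A i i) - quad_form M A \<theta>)
      \<le> (\<Sum>j=1..M. (real (c j) - real k * \<theta> j) * l j) - a * quad_form M A (\<lambda>j. real (c j) - real k * \<theta> j)"
proof (induction k)
  case 0
  have "(\<lambda>j\<in>{1..M}. 0) \<in> compositions M 0" by (auto simp: compositions_def)
  moreover have "quad_form M A (\<lambda>j. real ((\<lambda>j\<in>{1..M}. 0) j) - real 0 * \<theta> j) = 0"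
    by (simp add: quad_form_def)
  ultimately show ?case by (intro bexI[of _ "\<lambda>j\<in>{1..M}. 0"]) auto
next
  case (Suc k)
  let ?V = "(\<Sum>i=1..M. \<theta> i * A i i) - quad_form M A \<theta>"
  let ?d = "\<lambda>i j. (if j = i then 1 else 0) - \<theta> j"
  define W where "W v = (\<Sum>j=1..M. v j * l j) - a * quad_form M A v" for v
  have s1: "(\<Sum>i=1..M. \<theta> i) = 1" and pos: "\<And>i. i \<in> {1..M} \<Longrightarrow> 0 \<le> \<theta> i"
    using \<theta> by (auto simp: prob_simplex_def)
  obtain c where c: "c \<in> compositions M k"
    and IH: "- a * real k * ?V \<le> W (\<lambda>j. real (c j) - real k * \<theta> j)"
    using Suc unfolding W_def by blast
  define v where "v = (\<lambda>j. real (c j) - real k * \<theta> j)"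
  have W_step: "W (\<lambda>j. v j + ?d i j) = W v + (\<Sum>j=1..M. ?d i j * l j)
      - 2 * a * bilin_form M A v (?d i) - a * quad_form M A (?d i)" for i
    unfolding W_def quad_form_add[OF A]
    by (simp only: distrib_right[of "v _" "?d i _"] sum.distrib) (simp add: distrib_left)
  have "(\<Sum>i=1..M. \<theta> i * W (\<lambda>j. v j + ?d i j))
     = (\<Sum>i=1..M. \<theta> i * W v + \<theta> i * (\<Sum>j=1..M. ?d i j * l j)
         - 2 * a * (\<theta> i * bilin_form M A v (?d i)) - a * (\<theta> i * quad_form M A (?d i)))"
    unfolding W_step by (intro sum.cong) (auto simp: algebra_simps)
  also have "\<dots> = (\<Sum>i=1..M. \<theta> i) * W v + (\<Sum>i=1..M. \<theta> i * (\<Sum>j=1..M. ?d i j * l j))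
         - 2 * a * (\<Sum>i=1..M. \<theta> i * bilin_form M A v (?d i))
         - a * (\<Sum>i=1..M. \<theta> i * quad_form M A (?d i))"
    by (simp only: sum.distrib sum_subtractf sum_distrib_left[symmetric] sum_distrib_right[symmetric])
  also have "\<dots> = W v - a * ?V"
    unfolding bilin_form_linear_right mean_linear_increment[OF s1] mean_quad_increment[OF A s1] s1
    by simp
  finally have mean: "(\<Sum>i=1..M. \<theta> i * W (\<lambda>j. v j + ?d i j)) = W v - a * ?V" .
  obtain i where i: "i \<in> {1..M}" and "W v - a * ?V \<le> W (\<lambda>j. v j + ?d i j)"
    using exists_ge_weighted_mean[OF s1 pos, of "\<lambda>i. W (\<lambda>j. v j + ?d i j)"] unfolding mean by blast
  moreover have "(\<lambda>j. v j + ?d i j) = (\<lambda>j. real ((c(i := c i + 1)) j) - real (Suc k) * \<theta> j)"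
    by (auto simp: v_def algebra_simps)
  ultimately have "- a * real (Suc k) * ?V \<le> W (\<lambda>j. real ((c(i := c i + 1)) j) - real (Suc k) * \<theta> j)"
    using IH by (simp add: v_def algebra_simps)
  moreover have "c(i := c i + 1) \<in> compositions M (Suc k)"
  proof -
    have "(\<Sum>j=1..M. (c(i := c i + 1)) j) = (\<Sum>j=1..M. c j + (if j = i then 1 else 0))"
      by (intro sum.cong) auto
    also have "\<dots> = Suc k" using c i by (simp add: sum.distrib compositions_def)
    finally show ?thesis using c i by (auto simp: compositions_def PiE_iff extensional_def)
  qed
  ultimately show ?case unfolding W_def by blast
qed

text \<open>
  Restricted to \<open>{1..M}\<close> because elements of the simplex are extensional functions.
\<close>

definition barycentre :: "nat \<Rightarrow> nat \<Rightarrow> (nat \<Rightarrow> nat) \<Rightarrow> nat \<Rightarrow> real" where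
  "barycentre M m c = (\<lambda>j\<in>{1..M}. real (c j) / real m)"

lemma barycentre_in_prob_simplex:
  assumes "c \<in> compositions M m" "1 \<le> m"
  shows "barycentre M m c \<in> prob_simplex M"
proof -
  have "(\<Sum>j=1..M. barycentre M m c j) = (\<Sum>j=1..M. real (c j)) / real m"
    unfolding barycentre_def sum_divide_distrib by (intro sum.cong) auto
  also have "\<dots> = 1" using assms by (simp add: compositions_def flip: of_nat_sum)
  finally show ?thesis by (auto simp: prob_simplex_def barycentre_def)
qed

text \<open>
  With \<open>w\<close> the displacement from \<open>\<theta>\<close> to the barycentre, \<open>Q(\<theta> + w)\<close> contains the cross term
  \<open>2 \<theta>\<^sup>T A w\<close>. It is linear in \<open>w\<close>, and so it can be subtracted from the functional \<open>g\<close> to which the greedy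
  selection is applied. What is lost is \<open>a/m\<close> times the variance of one vertex, and this variance is
  at most the largest diagonal entry of \<open>A\<close>.
\<close>

lemma sparse_approximation:
  assumes A: "pos_semidef M A" and \<theta>: "\<theta> \<in> prob_simplex M" and m: "1 \<le> m"
    and diag: "\<And>j. j \<in> {1..M} \<Longrightarrow> A j j \<le> R\<^sup>2" and a: "0 \<le> a"
  shows "\<exists>c\<in>compositions M m. (\<Sum>j=1..M. \<theta> j * g j) - a * (quad_form M A \<theta> + R\<^sup>2 / real m)
      \<le> (\<Sum>j=1..M. barycentre M m c j * g j) - a * quad_form M A (barycentre M m c)"
proof -
  let ?V = "(\<Sum>i=1..M. \<theta> i * A i i) - quad_form M A \<theta>"
  \<comment> \<open>the functional of the greedy selection, corrected by the cross term and rescaled by \<open>m\<close>\<close>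
  let ?l = "\<lambda>j. real m * (g j - 2 * a * (\<Sum>i=1..M. \<theta> i * A i j))"
  obtain c where c: "c \<in> compositions M m"
    and ge: "- a * real m * ?V
      \<le> (\<Sum>j=1..M. (real (c j) - real m * \<theta> j) * ?l j) - a * quad_form M A (\<lambda>j. real (c j) - real m * \<theta> j)"
    using greedy_composition[OF A \<theta>, where l = ?l] by blast
  define w where "w = (\<lambda>j. (1 / real m) * (real (c j) - real m * \<theta> j))"
  have w: "real (c j) - real m * \<theta> j = real m * w j" for j
    using m by (simp add: w_def)
  have bary: "barycentre M m c j = \<theta> j + w j" if "j \<in> {1..M}" for j
    using m that by (simp add: barycentre_def w_def field_simps)
  have lin: "(\<Sum>j=1..M. (real m * w j) * ?l j)
      = (real m)\<^sup>2 * ((\<Sum>j=1..M. w j * g j) - 2 * a * bilin_form M A \<theta> w)"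
  proof -
    have "(\<Sum>j=1..M. (real m * w j) * ?l j)
      = (\<Sum>j=1..M. (real m)\<^sup>2 * (w j * g j - 2 * a * (w j * (\<Sum>i=1..M. \<theta> i * A i j))))"
      by (intro sum.cong) (auto simp: algebra_simps power2_eq_square)
    then show ?thesis
      unfolding bilin_form_linear_right
      by (simp only: sum_subtractf sum_distrib_left[symmetric])
  qed
  have V_le: "?V \<le> R\<^sup>2"
  proof -
    have "(\<Sum>i=1..M. \<theta> i * A i i) \<le> (\<Sum>i=1..M. \<theta> i * R\<^sup>2)"
      using \<theta> diag by (intro sum_mono mult_left_mono) (auto simp: prob_simplex_def)
    also have "\<dots> = R\<^sup>2" using \<theta> by (simp add: prob_simplex_def sum_distrib_right[symmetric])
    finally have "(\<Sum>i=1..M. \<theta> i * A i i) \<le> R\<^sup>2" .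
    moreover have "0 \<le> quad_form M A \<theta>" using A by (simp add: pos_semidef_def)
    ultimately show ?thesis by linarith
  qed
  define X where "X = (\<Sum>j=1..M. w j * g j) - 2 * a * bilin_form M A \<theta> w - a * quad_form M A w"
  have "- a * real m * ?V \<le> (real m)\<^sup>2 * X"
    using ge unfolding w lin quad_form_scale[OF A] X_def by (simp add: algebra_simps)
  then have "real m * (- a * ?V) \<le> real m * (X * real m)"
    by (simp add: power2_eq_square mult_ac)
  then have "- a * ?V \<le> X * real m"
    using m by (subst (asm) mult_le_cancel_left_pos) auto
  then have "- a * ?V / real m \<le> X"
    using m by (subst pos_divide_le_eq) auto
  moreover have "- a * R\<^sup>2 / real m \<le> - a * ?V / real m"
    using V_le a m by (intro divide_right_mono) (auto intro: mult_left_mono)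
  moreover have "(\<Sum>j=1..M. barycentre M m c j * g j) = (\<Sum>j=1..M. \<theta> j * g j) + (\<Sum>j=1..M. w j * g j)"
    unfolding sum.distrib[symmetric] by (intro sum.cong) (auto simp: bary algebra_simps)
  moreover have "quad_form M A (barycentre M m c) = quad_form M A \<theta> + 2 * bilin_form M A \<theta> w + quad_form M A w"
    unfolding quad_form_add[OF A, symmetric] by (rule quad_form_cong) (rule bary)
  ultimately show ?thesis
    unfolding X_def by (intro bexI[OF _ c]) (simp add: algebra_simps)
qed

section \<open>Exponential moments\<close>

lemma (in prob_space) rademacher_exp_moment:
  assumes "rademacher M X"
  shows "(\<integral>\<^sup>+\<omega>. ennreal (exp (X \<omega> * t)) \<partial>M) = ennreal (cosh t)"
proof -
  have X[measurable]: "X \<in> borel_measurable M"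
    and p1: "prob {\<omega>\<in>space M. X \<omega> = 1} = 1/2" and p2: "prob {\<omega>\<in>space M. X \<omega> = -1} = 1/2"
    using assms by (auto simp: rademacher_def)
  let ?A = "{\<omega>\<in>space M. X \<omega> = 1}" and ?B = "{\<omega>\<in>space M. X \<omega> = -1}"
  have "prob (?A \<union> ?B) = 1"
    using p1 p2 by (subst finite_measure_Union) auto
  then have "AE \<omega> in M. \<omega> \<in> ?A \<union> ?B"
    by (subst prob_eq_1[symmetric]) auto
  then have "(\<integral>\<^sup>+\<omega>. ennreal (exp (X \<omega> * t)) \<partial>M)
      = (\<integral>\<^sup>+\<omega>. ennreal (exp t) * indicator ?A \<omega> + ennreal (exp (-t)) * indicator ?B \<omega> \<partial>M)"
    by (intro nn_integral_cong_AE) (auto elim!: eventually_mono simp: indicator_def)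
  also have "\<dots> = ennreal (exp t) * emeasure M ?A + ennreal (exp (-t)) * emeasure M ?B"
    by (subst nn_integral_add) (auto simp: nn_integral_cmult_indicator)
  also have "\<dots> = ennreal (exp t * (1/2) + exp (-t) * (1/2))"
    unfolding emeasure_eq_measure p1 p2
    by (simp only: ennreal_mult[symmetric] ennreal_plus[symmetric] exp_ge_zero mult_nonneg_nonneg
        zero_le_divide_1_iff zero_le_numeral)
  finally show ?thesis by (simp add: cosh_field_def add_divide_distrib)
qed

text \<open>
  Independence makes the joint law of the pair a product measure, to which Tonelli's theorem applies.
\<close>

lemma (in prob_space) nn_integral_indep_rv:
  assumes ind: "indep_rv M S X T Y" and f: "case_prod f \<in> borel_measurable (S \<Otimes>\<^sub>M T)"
  shows "(\<integral>\<^sup>+\<omega>. f (X \<omega>) (Y \<omega>) \<partial>M) = (\<integral>\<^sup>+y. \<integral>\<^sup>+x. f x y \<partial>distr M S X \<partial>distr M T Y)"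
proof -
  have X[measurable]: "X \<in> M \<rightarrow>\<^sub>M S" and Y[measurable]: "Y \<in> M \<rightarrow>\<^sub>M T"
    and indep: "indep_set {X -` A \<inter> space M |A. A \<in> sets S} {Y -` B \<inter> space M |B. B \<in> sets T}"
    using ind by (auto simp: indep_rv_def)
  interpret X: prob_space "distr M S X" by (rule prob_space_distr) fact
  interpret Y: prob_space "distr M T Y" by (rule prob_space_distr) fact
  interpret XY: pair_sigma_finite "distr M S X" "distr M T Y" ..
  have joint: "distr M S X \<Otimes>\<^sub>M distr M T Y = distr M (S \<Otimes>\<^sub>M T) (\<lambda>\<omega>. (X \<omega>, Y \<omega>))"
  proof (rule pair_measure_eqI)
    fix A B assume "A \<in> sets (distr M S X)" "B \<in> sets (distr M T Y)"
    then have [measurable]: "A \<in> sets S" "B \<in> sets T" by simp_all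
    have "prob ((X -` A \<inter> space M) \<inter> (Y -` B \<inter> space M))
        = prob (X -` A \<inter> space M) * prob (Y -` B \<inter> space M)"
      by (rule indep_setD[OF indep]) auto
    moreover have "(\<lambda>\<omega>. (X \<omega>, Y \<omega>)) -` (A \<times> B) \<inter> space M = (X -` A \<inter> space M) \<inter> (Y -` B \<inter> space M)"
      by auto
    ultimately show "emeasure (distr M S X) A * emeasure (distr M T Y) B
        = emeasure (distr M (S \<Otimes>\<^sub>M T) (\<lambda>\<omega>. (X \<omega>, Y \<omega>))) (A \<times> B)"
      by (simp add: emeasure_distr emeasure_eq_measure ennreal_mult)
  qed (auto intro: X.sigma_finite_measure_axioms Y.sigma_finite_measure_axioms)
  have "(\<integral>\<^sup>+\<omega>. f (X \<omega>) (Y \<omega>) \<partial>M) = (\<integral>\<^sup>+p. case_prod f p \<partial>distr M (S \<Otimes>\<^sub>M T) (\<lambda>\<omega>. (X \<omega>, Y \<omega>)))"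
    using f by (simp add: nn_integral_distr)
  also have "\<dots> = (\<integral>\<^sup>+y. \<integral>\<^sup>+x. f x y \<partial>distr M S X \<partial>distr M T Y)"
    unfolding joint[symmetric]
    using XY.nn_integral_snd[of "case_prod f"] f by (simp cong: measurable_cong_sets)
  finally show ?thesis .
qed

lemma (in prob_space) nn_integral_prod_indep_vars:
  assumes ind: "indep_vars N X I" and fin: "finite I" "I \<noteq> {}"
    and f: "\<And>i. i \<in> I \<Longrightarrow> f i \<in> borel_measurable (N i)"
  shows "(\<integral>\<^sup>+x. (\<Prod>i\<in>I. f i (x i)) \<partial>distr M (\<Pi>\<^sub>M i\<in>I. N i) (\<lambda>\<omega>. \<lambda>i\<in>I. X i \<omega>))
      = (\<Prod>i\<in>I. \<integral>\<^sup>+\<omega>. f i (X i \<omega>) \<partial>M)"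
proof -
  have X: "X i \<in> M \<rightarrow>\<^sub>M N i" if "i \<in> I" for i
    using ind that by (auto simp: indep_vars_def2)
  note f[measurable] X[measurable]
  have "(\<integral>\<^sup>+x. (\<Prod>i\<in>I. f i (x i)) \<partial>distr M (\<Pi>\<^sub>M i\<in>I. N i) (\<lambda>\<omega>. \<lambda>i\<in>I. X i \<omega>))
      = (\<integral>\<^sup>+\<omega>. (\<Prod>i\<in>I. f i (X i \<omega>)) \<partial>M)"
  proof (subst nn_integral_distr)
    show "(\<lambda>\<omega>. \<lambda>i\<in>I. X i \<omega>) \<in> M \<rightarrow>\<^sub>M (\<Pi>\<^sub>M i\<in>I. N i)"
      by (intro measurable_restrict X)
    show "(\<lambda>x. \<Prod>i\<in>I. f i (x i)) \<in> borel_measurable (distr M (\<Pi>\<^sub>M i\<in>I. N i) (\<lambda>\<omega>. \<lambda>i\<in>I. X i \<omega>))"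
      by measurable
  qed simp_all
  also have "\<dots> = (\<Prod>i\<in>I. \<integral>\<^sup>+\<omega>. f i (X i \<omega>) \<partial>M)"
    by (rule indep_vars_nn_integral[OF fin(1) indep_vars_compose2[OF ind f]]) auto
  finally show ?thesis .
qed

text \<open>
  Conditionally on the \<open>Z i\<close>, each sign is integrated out and contributes a hyperbolic cosine; the
  factors that remain depend on different \<open>Z i\<close> and are independent.
\<close>

lemma (in prob_space) rademacher_sum_exp_moment:
  assumes fin: "finite I" "I \<noteq> {}"
    and \<epsilon>: "indep_vars (\<lambda>_. borel) \<epsilon> I" "\<And>i. i \<in> I \<Longrightarrow> rademacher M (\<epsilon> i)"
    and Z: "indep_vars (\<lambda>_. S) Z I"
    and ind: "indep_rv M (\<Pi>\<^sub>M i\<in>I. borel) (\<lambda>\<omega>. \<lambda>i\<in>I. \<epsilon> i \<omega>) (\<Pi>\<^sub>M i\<in>I. S) (\<lambda>\<omega>. \<lambda>i\<in>I. Z i \<omega>)"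
    and y[measurable]: "y \<in> borel_measurable S"
  shows "(\<integral>\<^sup>+\<omega>. ennreal (exp (\<Sum>i\<in>I. \<epsilon> i \<omega> * y (Z i \<omega>))) \<partial>M)
      = (\<Prod>i\<in>I. \<integral>\<^sup>+\<omega>. ennreal (cosh (y (Z i \<omega>))) \<partial>M)"
proof -
  define f where "f e z = (\<Prod>i\<in>I. ennreal (exp (e i * y (z i))))" for e :: "'b \<Rightarrow> real" and z
  have f: "case_prod f \<in> borel_measurable ((\<Pi>\<^sub>M i\<in>I. borel) \<Otimes>\<^sub>M (\<Pi>\<^sub>M i\<in>I. S))"
    unfolding f_def by measurable
  have "(\<integral>\<^sup>+\<omega>. ennreal (exp (\<Sum>i\<in>I. \<epsilon> i \<omega> * y (Z i \<omega>))) \<partial>M)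
      = (\<integral>\<^sup>+\<omega>. f (\<lambda>i\<in>I. \<epsilon> i \<omega>) (\<lambda>i\<in>I. Z i \<omega>) \<partial>M)"
    unfolding f_def by (intro nn_integral_cong) (simp add: exp_sum fin prod_ennreal)
  also have "\<dots> = (\<integral>\<^sup>+z. \<integral>\<^sup>+e. f e z \<partial>distr M (\<Pi>\<^sub>M i\<in>I. borel) (\<lambda>\<omega>. \<lambda>i\<in>I. \<epsilon> i \<omega>)
        \<partial>distr M (\<Pi>\<^sub>M i\<in>I. S) (\<lambda>\<omega>. \<lambda>i\<in>I. Z i \<omega>))"
    by (rule nn_integral_indep_rv[OF ind f])
  also have "\<dots> = (\<integral>\<^sup>+z. (\<Prod>i\<in>I. ennreal (cosh (y (z i)))) \<partial>distr M (\<Pi>\<^sub>M i\<in>I. S) (\<lambda>\<omega>. \<lambda>i\<in>I. Z i \<omega>))"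
    unfolding f_def
    by (intro nn_integral_cong, subst nn_integral_prod_indep_vars[OF \<epsilon>(1) fin])
      (auto intro!: prod.cong rademacher_exp_moment \<epsilon>(2))
  also have "\<dots> = (\<Prod>i\<in>I. \<integral>\<^sup>+\<omega>. ennreal (cosh (y (Z i \<omega>))) \<partial>M)"
    unfolding cosh_field_def by (rule nn_integral_prod_indep_vars[OF Z fin]) simp
  finally show ?thesis .
qed

lemma cosh_le_one_plus_square:
  fixes x :: real
  assumes "\<bar>x\<bar> \<le> 1"
  shows "cosh x \<le> 1 + x\<^sup>2"
proof -
  define t where "t = \<bar>x\<bar>"
  have t: "0 \<le> t" "t \<le> 1" using assms by (auto simp: t_def)
  have "exp t \<le> 1 + t + t\<^sup>2" by (rule exp_bound[OF t])
  moreover have "exp (-t) \<le> 1 - t + t\<^sup>2"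
  proof -
    have "exp (-t) \<le> 1 / (1 + t)"
      using exp_ge_add_one_self[of t] t by (simp add: exp_minus field_simps)
    also have "\<dots> \<le> 1 - t + t\<^sup>2"
      using t by (simp add: field_simps power2_eq_square)
    finally show ?thesis .
  qed
  ultimately have "cosh t \<le> 1 + t\<^sup>2" by (simp add: cosh_field_def)
  then show ?thesis by (simp add: t_def)
qed

text \<open>
  A Bernstein-type bound: the range of \<open>y\<close> enters through the comparison with \<open>1 + y\<^sup>2\<close> alone, so that
  the exponent is the second moment.
\<close>

lemma (in prob_space) nn_integral_cosh_le:
  assumes y[measurable]: "y \<in> borel_measurable M" and bd: "AE \<omega> in M. \<bar>y \<omega>\<bar> \<le> 1"
  shows "(\<integral>\<^sup>+\<omega>. ennreal (cosh (y \<omega>)) \<partial>M) \<le> ennreal (exp (\<integral>\<omega>. (y \<omega>)\<^sup>2 \<partial>M))"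
proof -
  have int: "integrable M (\<lambda>\<omega>. (y \<omega>)\<^sup>2)"
    using bd by (intro integrable_const_bound[of _ 1]) (auto elim!: eventually_mono simp: abs_square_le_1)
  have "(\<integral>\<^sup>+\<omega>. ennreal (cosh (y \<omega>)) \<partial>M) \<le> (\<integral>\<^sup>+\<omega>. ennreal (1 + (y \<omega>)\<^sup>2) \<partial>M)"
    using bd by (intro nn_integral_mono_AE) (auto elim!: eventually_mono intro: ennreal_leI cosh_le_one_plus_square simp del: ennreal_plus)
  also have "\<dots> = ennreal (1 + (\<integral>\<omega>. (y \<omega>)\<^sup>2 \<partial>M))"
    using int by (subst nn_integral_eq_integral) (auto simp: prob_space)
  also have "\<dots> \<le> ennreal (exp (\<integral>\<omega>. (y \<omega>)\<^sup>2 \<partial>M))"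
    by (intro ennreal_leI) (rule exp_ge_add_one_self)
  finally show ?thesis .
qed

lemma (in prob_space) rademacher_sum_exp_moment_le:
  assumes n: "1 \<le> n"
    and Z: "iid M S n Z"
    and \<epsilon>: "iid M borel n \<epsilon>" "\<forall>i\<in>{1..n}. rademacher M (\<epsilon> i)"
    and ind: "indep_rv M (\<Pi>\<^sub>M i\<in>{1..n}. borel) (\<lambda>\<omega>. \<lambda>i\<in>{1..n}. \<epsilon> i \<omega>)
                 (\<Pi>\<^sub>M i\<in>{1..n}. S) (\<lambda>\<omega>. \<lambda>i\<in>{1..n}. Z i \<omega>)"
    and y[measurable]: "y \<in> borel_measurable S" and bd: "AE \<omega> in M. \<bar>y (Z 1 \<omega>)\<bar> \<le> 1"
  shows "(\<integral>\<^sup>+\<omega>. ennreal (exp (\<Sum>i=1..n. \<epsilon> i \<omega> * y (Z i \<omega>))) \<partial>M)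
      \<le> ennreal (exp (real n * (\<integral>\<omega>. (y (Z 1 \<omega>))\<^sup>2 \<partial>M)))"
proof -
  have Zm: "Z i \<in> M \<rightarrow>\<^sub>M S" if "i \<in> {1..n}" for i
    using Z that by (auto simp: iid_def indep_vars_def2)
  have Z1: "Z 1 \<in> M \<rightarrow>\<^sub>M S" using Zm n by simp
  have same: "(\<integral>\<^sup>+\<omega>. ennreal (cosh (y (Z i \<omega>))) \<partial>M) = (\<integral>\<^sup>+\<omega>. ennreal (cosh (y (Z 1 \<omega>))) \<partial>M)"
    if i: "i \<in> {1..n}" for i
  proof -
    have cm: "(\<lambda>z. ennreal (cosh (y z))) \<in> borel_measurable (distr M S X)" for X
      unfolding cosh_field_def by measurable
    have "distr M S (Z i) = distr M S (Z 1)"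
      using Z i n unfolding iid_def by (meson atLeastAtMost_iff order_refl)
    then have "(\<integral>\<^sup>+z. ennreal (cosh (y z)) \<partial>distr M S (Z i)) = (\<integral>\<^sup>+z. ennreal (cosh (y z)) \<partial>distr M S (Z 1))"
      by simp
    then show ?thesis
      using nn_integral_distr[OF Zm[OF i], of "\<lambda>z. ennreal (cosh (y z))"]
        nn_integral_distr[OF Z1, of "\<lambda>z. ennreal (cosh (y z))"] by (simp only: cm)
  qed
  have "(\<integral>\<^sup>+\<omega>. ennreal (exp (\<Sum>i=1..n. \<epsilon> i \<omega> * y (Z i \<omega>))) \<partial>M)
      = (\<Prod>i=1..n. \<integral>\<^sup>+\<omega>. ennreal (cosh (y (Z i \<omega>))) \<partial>M)"
    using n Z \<epsilon> ind by (intro rademacher_sum_exp_moment) (auto simp: iid_def)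
  also have "\<dots> = (\<Prod>i=1..n. \<integral>\<^sup>+\<omega>. ennreal (cosh (y (Z 1 \<omega>))) \<partial>M)"
    by (intro prod.cong refl) (rule same)
  also have "\<dots> = (\<integral>\<^sup>+\<omega>. ennreal (cosh (y (Z 1 \<omega>))) \<partial>M) ^ n"
    by simp
  also have "\<dots> \<le> ennreal (exp (\<integral>\<omega>. (y (Z 1 \<omega>))\<^sup>2 \<partial>M)) ^ n"
    by (intro power_mono nn_integral_cosh_le bd measurable_compose[OF Z1 y]) auto
  also have "\<dots> = ennreal (exp (real n * (\<integral>\<omega>. (y (Z 1 \<omega>))\<^sup>2 \<partial>M)))"
    by (simp add: ennreal_power exp_of_nat_mult)
  finally show ?thesis .
qed

section \<open>The supremum of the process\<close>

lemma lin_comb_measurable: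
  assumes "\<forall>j\<in>{1..M}. h j \<in> borel_measurable S"
  shows "lin_comb M h \<theta> \<in> borel_measurable S"
  unfolding lin_comb_def using assms by (intro borel_measurable_sum borel_measurable_times) auto

lemma abs_lin_comb_le:
  assumes "\<theta> \<in> prob_simplex M" "\<And>j. j \<in> {1..M} \<Longrightarrow> \<bar>h j z\<bar> \<le> b"
  shows "\<bar>lin_comb M h \<theta> z\<bar> \<le> b"
proof -
  have "\<bar>lin_comb M h \<theta> z\<bar> \<le> (\<Sum>j=1..M. \<bar>\<theta> j * h j z\<bar>)"
    unfolding lin_comb_def by (rule sum_abs)
  also have "\<dots> \<le> (\<Sum>j=1..M. \<theta> j * b)"
    using assms by (intro sum_mono) (auto simp: prob_simplex_def abs_mult intro: mult_left_mono)
  also have "\<dots> = b" using assms(1) by (simp add: prob_simplex_def sum_distrib_right[symmetric])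
  finally show ?thesis .
qed

text \<open>
  The exponential of the penalised process at the point \<open>u\<close> with sign \<open>s\<close>; without penalty
  (\<open>a = 0\<close>) the absolute value of the process would be the larger one of the two exponents for
  \<open>s = 1\<close> and \<open>s = -1\<close>, divided by \<open>\<gamma>\<close>.
\<close>

definition exp_weight ::
  "nat \<Rightarrow> nat \<Rightarrow> (nat \<Rightarrow> nat \<Rightarrow> real) \<Rightarrow> (nat \<Rightarrow> 'w \<Rightarrow> real) \<Rightarrow> (nat \<Rightarrow> 'w \<Rightarrow> 'z) \<Rightarrow> (nat \<Rightarrow> 'z \<Rightarrow> real) \<Rightarrow>
     real \<Rightarrow> real \<Rightarrow> real \<Rightarrow> (nat \<Rightarrow> real) \<Rightarrow> 'w \<Rightarrow> real" where
  "exp_weight M n A \<epsilon> Z h \<gamma> a s u \<omega> =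
     exp (\<gamma> * (s * (1 / real n * (\<Sum>i=1..n. \<epsilon> i \<omega> * lin_comb M h u (Z i \<omega>))) - a * quad_form M A u))"

text \<open>
  The maximum over the barycentres is dominated by a soft maximum, the logarithm of a sum of
  exponentials. The logarithm is replaced by its tangent \<open>ln Y \<le> K - 1 + exp(-K) Y\<close>, so that the bound is
  affine in the exponential weights. It can then be integrated directly, and taking \<open>exp K\<close> of the size
  of the number of weights costs no more than Jensen's inequality would.
\<close>

lemma rademacher_process_softmax:
  fixes \<epsilon> :: "nat \<Rightarrow> 'w \<Rightarrow> real" and Z :: "nat \<Rightarrow> 'w \<Rightarrow> 'z"
  assumes A: "pos_semidef M A" and \<theta>: "\<theta> \<in> prob_simplex M" and m: "1 \<le> m"
    and diag: "\<And>j. j \<in> {1..M} \<Longrightarrow> A j j \<le> R\<^sup>2" and a: "0 \<le> a" and \<gamma>: "0 < \<gamma>"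
  shows "rademacher_process M n \<epsilon> Z h \<theta> \<omega> \<le> a * (quad_form M A \<theta> + R\<^sup>2 / real m) + (K - 1) / \<gamma>
    + exp (- K) / \<gamma> * (\<Sum>c\<in>compositions M m. \<Sum>s\<in>{-1, 1}. exp_weight M n A \<epsilon> Z h \<gamma> a s (barycentre M m c) \<omega>)"
proof -
  define G where "G u = 1 / real n * (\<Sum>i=1..n. \<epsilon> i \<omega> * lin_comb M h u (Z i \<omega>))" for u
  define Y where "Y = (\<Sum>c\<in>compositions M m. \<Sum>s\<in>{-1, 1}. exp_weight M n A \<epsilon> Z h \<gamma> a s (barycentre M m c) \<omega>)"
  \<comment> \<open>for the right sign \<open>s\<close> the absolute value at \<open>\<theta>\<close> is the value of a linear functional\<close>
  obtain s :: real where s: "s \<in> {-1, 1}" and "\<bar>G \<theta>\<bar> = s * G \<theta>"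
    using that[of 1] that[of "-1"] by (cases "0 \<le> G \<theta>") auto
  then have proc: "rademacher_process M n \<epsilon> Z h \<theta> \<omega> = s * G \<theta>"
    unfolding rademacher_process_def G_def by (simp add: abs_mult)
  define g where "g j = s * (1 / real n * (\<Sum>i=1..n. \<epsilon> i \<omega> * h j (Z i \<omega>)))" for j
  have lin: "s * G u = (\<Sum>j=1..M. u j * g j)" for u
  proof -
    have "s * G u = (\<Sum>i=1..n. \<Sum>j=1..M. s * (1 / real n) * (\<epsilon> i \<omega> * (u j * h j (Z i \<omega>))))"
      by (simp add: G_def lin_comb_def sum_distrib_left mult_ac)
    also have "\<dots> = (\<Sum>j=1..M. \<Sum>i=1..n. s * (1 / real n) * (\<epsilon> i \<omega> * (u j * h j (Z i \<omega>))))"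
      by (rule sum.swap)
    also have "\<dots> = (\<Sum>j=1..M. u j * g j)"
      by (simp add: g_def sum_distrib_left mult_ac)
    finally show ?thesis .
  qed
  obtain c where c: "c \<in> compositions M m"
    and approx: "s * G \<theta> - a * (quad_form M A \<theta> + R\<^sup>2 / real m)
      \<le> s * G (barycentre M m c) - a * quad_form M A (barycentre M m c)" (is "_ \<le> ?w")
    using sparse_approximation[OF A \<theta> m diag a, of g] unfolding lin by blast
  have "exp (\<gamma> * ?w) \<le> Y"
  proof -
    have "exp (\<gamma> * ?w) = exp_weight M n A \<epsilon> Z h \<gamma> a s (barycentre M m c) \<omega>"
      by (simp add: exp_weight_def G_def)
    also have "\<dots> \<le> (\<Sum>s\<in>{-1, 1}. exp_weight M n A \<epsilon> Z h \<gamma> a s (barycentre M m c) \<omega>)"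
      using s by (intro member_le_sum) (auto simp: exp_weight_def)
    also have "\<dots> \<le> Y"
      unfolding Y_def
      by (rule member_le_sum[OF c, of "\<lambda>c. \<Sum>s\<in>{-1, 1}. exp_weight M n A \<epsilon> Z h \<gamma> a s (barycentre M m c) \<omega>"])
        (auto simp: exp_weight_def finite_compositions)
    finally show ?thesis .
  qed
  have "\<gamma> * ?w - K + 1 \<le> exp (\<gamma> * ?w - K)"
    using exp_ge_add_one_self[of "\<gamma> * ?w - K"] by linarith
  also have "\<dots> = exp (- K) * exp (\<gamma> * ?w)" by (simp add: exp_add[symmetric])
  also have "\<dots> \<le> exp (- K) * Y" using \<open>exp (\<gamma> * ?w) \<le> Y\<close> by simp
  finally have "?w \<le> (K - 1 + exp (- K) * Y) / \<gamma>"
    unfolding pos_le_divide_eq[OF \<gamma>] mult.commute[of _ \<gamma>] by linarith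
  then have "s * G \<theta> \<le> a * (quad_form M A \<theta> + R\<^sup>2 / real m) + (K - 1 + exp (- K) * Y) / \<gamma>"
    using approx by linarith
  then show ?thesis unfolding proc Y_def by (simp add: add_divide_distrib)
qed

text \<open>
  The penalty level \<open>\<gamma> L/n\<close> is the one for which the penalty and the second moment bound cancel.
\<close>

lemma (in prob_space) exp_weight_moment_le_1:
  assumes n: "1 \<le> n"
    and Z: "iid M S n Z"
    and \<epsilon>: "iid M borel n \<epsilon>" "\<forall>i\<in>{1..n}. rademacher M (\<epsilon> i)"
    and ind: "indep_rv M (\<Pi>\<^sub>M i\<in>{1..n}. borel) (\<lambda>\<omega>. \<lambda>i\<in>{1..n}. \<epsilon> i \<omega>)
                 (\<Pi>\<^sub>M i\<in>{1..n}. S) (\<lambda>\<omega>. \<lambda>i\<in>{1..n}. Z i \<omega>)"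
    and h: "\<forall>j\<in>{1..d}. h j \<in> borel_measurable S"
    and b: "\<forall>j\<in>{1..d}. AE \<omega> in M. \<bar>h j (Z 1 \<omega>)\<bar> \<le> b"
    and u: "u \<in> prob_simplex d"
    and var: "(\<integral>\<omega>. (lin_comb d h u (Z 1 \<omega>))\<^sup>2 \<partial>M) \<le> L * quad_form d A u"
    and \<gamma>: "0 < \<gamma>" "\<gamma> * b \<le> real n" and s: "s \<in> {-1, 1}"
  shows "(\<integral>\<^sup>+\<omega>. ennreal (exp_weight d n A \<epsilon> Z h \<gamma> (\<gamma> * L / real n) s u \<omega>) \<partial>M) \<le> 1"
proof -
  define q where "q = \<gamma> * (\<gamma> * L / real n * quad_form d A u)"
  define y where "y z = \<gamma> * s / real n * lin_comb d h u z" for z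
  have ym: "y \<in> borel_measurable S"
    unfolding y_def using lin_comb_measurable[OF h] by (intro borel_measurable_times) auto
  have s1: "\<bar>s\<bar> = 1" "s\<^sup>2 = 1" using s by auto
  have "AE \<omega> in M. \<forall>j\<in>{1..d}. \<bar>h j (Z 1 \<omega>)\<bar> \<le> b"
    using b by (intro AE_finite_allI) auto
  then have bd: "AE \<omega> in M. \<bar>y (Z 1 \<omega>)\<bar> \<le> 1"
  proof (rule eventually_mono)
    fix \<omega> assume "\<forall>j\<in>{1..d}. \<bar>h j (Z 1 \<omega>)\<bar> \<le> b"
    then have "\<bar>lin_comb d h u (Z 1 \<omega>)\<bar> \<le> b" by (intro abs_lin_comb_le[OF u]) auto
    then have "\<gamma> * \<bar>lin_comb d h u (Z 1 \<omega>)\<bar> \<le> real n"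
      using \<gamma> by (meson mult_left_mono order_trans less_imp_le)
    then show "\<bar>y (Z 1 \<omega>)\<bar> \<le> 1"
      using \<gamma> n by (simp add: y_def abs_mult s1)
  qed
  have "real n * (\<integral>\<omega>. (y (Z 1 \<omega>))\<^sup>2 \<partial>M) = \<gamma>\<^sup>2 / real n * (\<integral>\<omega>. (lin_comb d h u (Z 1 \<omega>))\<^sup>2 \<partial>M)"
    using n by (simp add: y_def power_mult_distrib power_divide s1) (simp add: power2_eq_square)
  also have "\<dots> \<le> \<gamma>\<^sup>2 / real n * (L * quad_form d A u)"
    by (intro mult_left_mono var) auto
  also have "\<dots> = q" by (simp add: q_def power2_eq_square)
  finally have le: "real n * (\<integral>\<omega>. (y (Z 1 \<omega>))\<^sup>2 \<partial>M) \<le> q" .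
  have eq: "exp_weight d n A \<epsilon> Z h \<gamma> (\<gamma> * L / real n) s u \<omega>
      = exp (- q) * exp (\<Sum>i=1..n. \<epsilon> i \<omega> * y (Z i \<omega>))" for \<omega>
  proof -
    have "(\<Sum>i=1..n. \<epsilon> i \<omega> * y (Z i \<omega>)) = \<gamma> * (s * (1 / real n * (\<Sum>i=1..n. \<epsilon> i \<omega> * lin_comb d h u (Z i \<omega>))))"
      by (simp add: y_def sum_distrib_left mult_ac)
    then show ?thesis by (simp add: exp_weight_def q_def right_diff_distrib exp_diff exp_minus field_simps)
  qed
  have [measurable]: "\<epsilon> i \<in> borel_measurable M" "(\<lambda>\<omega>. y (Z i \<omega>)) \<in> borel_measurable M" if "i \<in> {1..n}" for i
    using \<epsilon>(1) Z that ym by (auto simp: iid_def indep_vars_def2 intro: measurable_compose)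
  have "(\<integral>\<^sup>+\<omega>. ennreal (exp_weight d n A \<epsilon> Z h \<gamma> (\<gamma> * L / real n) s u \<omega>) \<partial>M)
      = ennreal (exp (- q)) * (\<integral>\<^sup>+\<omega>. ennreal (exp (\<Sum>i=1..n. \<epsilon> i \<omega> * y (Z i \<omega>))) \<partial>M)"
    unfolding eq by (subst nn_integral_cmult[symmetric]) (auto simp: ennreal_mult)
  also have "\<dots> \<le> ennreal (exp (- q)) * ennreal (exp (real n * (\<integral>\<omega>. (y (Z 1 \<omega>))\<^sup>2 \<partial>M)))"
    by (intro mult_left_mono rademacher_sum_exp_moment_le[OF n Z \<epsilon> ind ym bd]) auto
  also have "\<dots> \<le> ennreal (exp (- q)) * ennreal (exp q)"
    using le by (intro mult_left_mono ennreal_leI) auto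
  also have "\<dots> = 1" by (simp add: ennreal_mult[symmetric] exp_add[symmetric])
  finally show ?thesis .
qed

text \<open>
  The bound with free parameters: the scale \<open>\<gamma>\<close> of the exponential moments, the number \<open>m\<close> of vertices
  and the entropy bound \<open>K\<close>.
\<close>

lemma (in prob_space) expected_sup_le:
  fixes Z :: "nat \<Rightarrow> 'a \<Rightarrow> 'z" and \<epsilon> :: "nat \<Rightarrow> 'a \<Rightarrow> real"
  assumes n: "1 \<le> n" and A: "pos_semidef d A" and L: "0 < L"
    and Z: "iid M S n Z"
    and \<epsilon>: "iid M borel n \<epsilon>" "\<forall>i\<in>{1..n}. rademacher M (\<epsilon> i)"
    and ind: "indep_rv M (\<Pi>\<^sub>M i\<in>{1..n}. borel) (\<lambda>\<omega>. \<lambda>i\<in>{1..n}. \<epsilon> i \<omega>)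
                 (\<Pi>\<^sub>M i\<in>{1..n}. S) (\<lambda>\<omega>. \<lambda>i\<in>{1..n}. Z i \<omega>)"
    and h: "\<forall>j\<in>{1..d}. h j \<in> borel_measurable S"
    and b: "\<forall>j\<in>{1..d}. AE \<omega> in M. \<bar>h j (Z 1 \<omega>)\<bar> \<le> b"
    and diag: "\<forall>j\<in>{1..d}. A j j \<le> R\<^sup>2"
    and var: "\<forall>\<theta>\<in>prob_simplex d. (\<integral>\<omega>. (lin_comb d h \<theta> (Z 1 \<omega>))\<^sup>2 \<partial>M) \<le> L * quad_form d A \<theta>"
    and \<gamma>: "0 < \<gamma>" "\<gamma> * b \<le> real n" and m: "1 \<le> m" "R\<^sup>2 / real m \<le> 2 * r\<^sup>2"
    and K: "1 \<le> K" "2 * real (card (compositions d m)) \<le> exp K"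
  shows "(\<integral>\<^sup>+\<omega>. (SUP \<theta>\<in>{\<theta> \<in> prob_simplex d. quad_form d A \<theta> \<le> r\<^sup>2}.
                  ennreal (rademacher_process d n \<epsilon> Z h \<theta> \<omega>)) \<partial>M)
        \<le> ennreal (3 * r\<^sup>2 * \<gamma> * L / real n + K / \<gamma>)"
proof -
  define a where "a = \<gamma> * L / real n"
  have a: "0 \<le> a" using \<gamma> L by (simp add: a_def)
  define C where "C = a * (3 * r\<^sup>2) + (K - 1) / \<gamma>"
  have C: "0 \<le> C" using a \<gamma> K by (simp add: C_def)
  let ?w = "\<lambda>c s. exp_weight d n A \<epsilon> Z h \<gamma> a s (barycentre d m c)"
  define Y where "Y \<omega> = (\<Sum>c\<in>compositions d m. \<Sum>s\<in>{-1, 1}. ?w c s \<omega>)" for \<omega>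
  have Y0: "0 \<le> Y \<omega>" for \<omega> unfolding Y_def by (intro sum_nonneg) (auto simp: exp_weight_def)
  have "(\<lambda>\<omega>. \<epsilon> i \<omega> * lin_comb d h u (Z i \<omega>)) \<in> borel_measurable M" if "i \<in> {1..n}" for i u
  proof (rule borel_measurable_times)
    show "\<epsilon> i \<in> borel_measurable M" using \<epsilon>(1) that by (auto simp: iid_def indep_vars_def2)
    have "Z i \<in> M \<rightarrow>\<^sub>M S" using Z that by (auto simp: iid_def indep_vars_def2)
    then show "(\<lambda>\<omega>. lin_comb d h u (Z i \<omega>)) \<in> borel_measurable M"
      by (rule measurable_compose[OF _ lin_comb_measurable[OF h]])
  qed
  then have w[measurable]: "?w c s \<in> borel_measurable M" for c s
    unfolding exp_weight_def by measurable
  have Ym[measurable]: "Y \<in> borel_measurable M" unfolding Y_def by measurable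
  have "(SUP \<theta>\<in>{\<theta> \<in> prob_simplex d. quad_form d A \<theta> \<le> r\<^sup>2}. ennreal (rademacher_process d n \<epsilon> Z h \<theta> \<omega>))
      \<le> ennreal C + ennreal (exp (- K) / \<gamma>) * ennreal (Y \<omega>)" for \<omega>
  proof (rule SUP_least)
    fix \<theta> assume "\<theta> \<in> {\<theta> \<in> prob_simplex d. quad_form d A \<theta> \<le> r\<^sup>2}"
    then have \<theta>: "\<theta> \<in> prob_simplex d" "quad_form d A \<theta> \<le> r\<^sup>2" by auto
    have "rademacher_process d n \<epsilon> Z h \<theta> \<omega>
        \<le> a * (quad_form d A \<theta> + R\<^sup>2 / real m) + (K - 1) / \<gamma> + exp (- K) / \<gamma> * Y \<omega>"
      unfolding Y_def using diag by (intro rademacher_process_softmax[OF A \<theta>(1) m(1) _ a \<gamma>(1)]) auto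
    also have "a * (quad_form d A \<theta> + R\<^sup>2 / real m) \<le> a * (3 * r\<^sup>2)"
      using \<theta>(2) m(2) a by (intro mult_left_mono) auto
    finally have "ennreal (rademacher_process d n \<epsilon> Z h \<theta> \<omega>) \<le> ennreal (C + exp (- K) / \<gamma> * Y \<omega>)"
      unfolding C_def by (intro ennreal_leI) simp
    also have "\<dots> = ennreal C + ennreal (exp (- K) / \<gamma>) * ennreal (Y \<omega>)"
      using C Y0[of \<omega>] \<gamma> by (simp add: ennreal_mult[symmetric])
    finally show "ennreal (rademacher_process d n \<epsilon> Z h \<theta> \<omega>) \<le> \<dots>" .
  qed
  then have "(\<integral>\<^sup>+\<omega>. (SUP \<theta>\<in>{\<theta> \<in> prob_simplex d. quad_form d A \<theta> \<le> r\<^sup>2}.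
        ennreal (rademacher_process d n \<epsilon> Z h \<theta> \<omega>)) \<partial>M)
      \<le> (\<integral>\<^sup>+\<omega>. ennreal C + ennreal (exp (- K) / \<gamma>) * ennreal (Y \<omega>) \<partial>M)"
    by (intro nn_integral_mono)
  also have "\<dots> = ennreal C + ennreal (exp (- K) / \<gamma>) * (\<integral>\<^sup>+\<omega>. ennreal (Y \<omega>) \<partial>M)"
    by (subst nn_integral_add) (auto simp: nn_integral_cmult emeasure_space_1)
  also have "(\<integral>\<^sup>+\<omega>. ennreal (Y \<omega>) \<partial>M) \<le> ennreal (exp K)"
  proof -
    have "(\<integral>\<^sup>+\<omega>. ennreal (Y \<omega>) \<partial>M) = (\<integral>\<^sup>+\<omega>. (\<Sum>c\<in>compositions d m. \<Sum>s\<in>{-1, 1}. ennreal (?w c s \<omega>)) \<partial>M)"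
      unfolding Y_def
      by (intro nn_integral_cong) (subst sum_ennreal[symmetric], auto intro!: sum_nonneg simp: exp_weight_def)
    also have "\<dots> = (\<Sum>c\<in>compositions d m. \<Sum>s\<in>{-1, 1}. (\<integral>\<^sup>+\<omega>. ennreal (?w c s \<omega>) \<partial>M))"
      by (subst nn_integral_sum, simp, intro sum.cong refl nn_integral_sum) simp
    also have "\<dots> \<le> (\<Sum>c\<in>compositions d m. \<Sum>s\<in>{-1, 1::real}. 1)"
      unfolding a_def using var barycentre_in_prob_simplex[OF _ m(1)]
      by (intro sum_mono exp_weight_moment_le_1[OF n Z \<epsilon> ind h b _ _ \<gamma>]) auto
    also have "\<dots> = ennreal (2 * real (card (compositions d m)))"
      by (simp add: ennreal_mult ennreal_of_nat_eq_real_of_nat mult.commute)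
    also have "\<dots> \<le> ennreal (exp K)" by (intro ennreal_leI K)
    finally show ?thesis .
  qed
  also have "ennreal C + ennreal (exp (- K) / \<gamma>) * ennreal (exp K) = ennreal (C + 1 / \<gamma>)"
    using C \<gamma> by (simp add: ennreal_mult[symmetric] exp_minus)
  also have "C + 1 / \<gamma> = 3 * r\<^sup>2 * \<gamma> * L / real n + K / \<gamma>"
    by (simp add: C_def a_def diff_divide_distrib)
  finally show ?thesis by (simp add: add_mono mult_left_mono)
qed

text \<open>
  Below the threshold \<open>sqrt(DN/(LB))\<close> the first summand \<open>3B\<gamma>L/N\<close> is at most \<open>3D/\<gamma>\<close>. So the sum is at most
  \<open>7D/\<gamma>\<close>, whichever of the two expressions attains the minimum in \<open>\<gamma>\<close>.
\<close>

lemma optimal_scale: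
  fixes L B D b N :: real
  assumes "0 < L" "0 < B" "0 < D" "0 < b" "0 < N"
  defines "\<gamma> \<equiv> min (N / b) (sqrt (D * N / (L * B)))"
  shows "0 < \<gamma>" "\<gamma> * b \<le> N" "3 * B * \<gamma> * L / N + 4 * D / \<gamma> \<le> 7 * max (sqrt (L * B * D / N)) (b * D / N)"
proof -
  show \<gamma>0: "0 < \<gamma>" using assms(1-5) by (simp add: \<gamma>_def)
  have "\<gamma> \<le> N / b" by (simp add: \<gamma>_def)
  then show "\<gamma> * b \<le> N" using assms(4) by (simp add: pos_le_divide_eq)
  have "\<gamma>\<^sup>2 \<le> (sqrt (D * N / (L * B)))\<^sup>2"
    using \<gamma>0 by (intro power_mono) (auto simp: \<gamma>_def)
  then have "\<gamma>\<^sup>2 \<le> D * N / (L * B)" using assms(1-5) by simp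
  then have "3 * B * \<gamma> * L / N \<le> 3 * D / \<gamma>"
    using assms(1-5) \<gamma>0 by (simp add: field_simps power2_eq_square)
  then have "3 * B * \<gamma> * L / N + 4 * D / \<gamma> \<le> 7 * (D / \<gamma>)" by simp
  also have "D / \<gamma> \<le> max (sqrt (L * B * D / N)) (b * D / N)"
  proof (cases "N / b \<le> sqrt (D * N / (L * B))")
    case True
    then have "D / \<gamma> = b * D / N" by (simp add: \<gamma>_def)
    then show ?thesis by simp
  next
    case False
    have "D = sqrt (D\<^sup>2)" using assms(1-5) by simp
    also have "D\<^sup>2 = (L * B * D / N) * (D * N / (L * B))"
      using assms by (simp add: power2_eq_square)
    finally have "D = sqrt (L * B * D / N) * sqrt (D * N / (L * B))" by (simp only: real_sqrt_mult)
    moreover have "\<gamma> = sqrt (D * N / (L * B))" using False by (simp add: \<gamma>_def)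
    ultimately have "D = sqrt (L * B * D / N) * \<gamma>" by (simp only:)
    then have "D / \<gamma> = sqrt (L * B * D / N) * \<gamma> / \<gamma>" by (rule arg_cong)
    then have "D / \<gamma> = sqrt (L * B * D / N)" using \<gamma>0 by simp
    then show ?thesis by simp
  qed
  finally show "3 * B * \<gamma> * L / N + 4 * D / \<gamma> \<le> 7 * max (sqrt (L * B * D / N)) (b * D / N)"
    by simp
qed

text \<open>
  The parameters are chosen in terms of \<open>T = R\<^sup>2/r\<^sup>2\<close>. The hypothesis on \<open>r\<close> says that \<open>1 \<le> T \<le> d\<close>, and
  this is what the entropy bound for the integer part of \<open>T\<close> demands.
\<close>

lemma (in prob_space) expected_localized_sup_le:
  fixes Z :: "nat \<Rightarrow> 'a \<Rightarrow> 'z" and \<epsilon> :: "nat \<Rightarrow> 'a \<Rightarrow> real"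
  assumes n: "1 \<le> n" and A: "pos_semidef d A" and pos: "0 < b" "0 < R" "0 < L"
    and Z: "iid M S n Z"
    and \<epsilon>: "iid M borel n \<epsilon>" "\<forall>i\<in>{1..n}. rademacher M (\<epsilon> i)"
    and ind: "indep_rv M (\<Pi>\<^sub>M i\<in>{1..n}. borel) (\<lambda>\<omega>. \<lambda>i\<in>{1..n}. \<epsilon> i \<omega>)
                 (\<Pi>\<^sub>M i\<in>{1..n}. S) (\<lambda>\<omega>. \<lambda>i\<in>{1..n}. Z i \<omega>)"
    and h: "\<forall>j\<in>{1..d}. h j \<in> borel_measurable S"
    and b: "\<forall>j\<in>{1..d}. AE \<omega> in M. \<bar>h j (Z 1 \<omega>)\<bar> \<le> b"
    and diag: "\<forall>j\<in>{1..d}. A j j \<le> R\<^sup>2"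
    and var: "\<forall>\<theta>\<in>prob_simplex d. (\<integral>\<omega>. (lin_comb d h \<theta> (Z 1 \<omega>))\<^sup>2 \<partial>M) \<le> L * quad_form d A \<theta>"
    and r: "0 < r" "R / sqrt (real d) \<le> r" "r \<le> R" and d: "1 \<le> d"
  shows "(\<integral>\<^sup>+\<omega>. (SUP \<theta>\<in>{\<theta> \<in> prob_simplex d. quad_form d A \<theta> \<le> r\<^sup>2}.
                  ennreal (rademacher_process d n \<epsilon> Z h \<theta> \<omega>)) \<partial>M)
        \<le> ennreal (7 * max (sqrt L * R * sqrt (ln (exp 1 * real d * r\<^sup>2 / R\<^sup>2) / real n))
                           (b * R\<^sup>2 * ln (exp 1 * real d * r\<^sup>2 / R\<^sup>2) / (r\<^sup>2 * real n)))"
proof -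
  define T where "T = R\<^sup>2 / r\<^sup>2"
  define l where "l = ln (exp 1 * real d * r\<^sup>2 / R\<^sup>2)"
  define m where "m = nat \<lfloor>T\<rfloor>"
  define D where "D = T * l"
  have T1: "1 \<le> T" using r pos by (simp add: T_def power_mono)
  have Td: "T \<le> real d"
  proof -
    have "R \<le> r * sqrt (real d)" using r(2) d by (simp add: divide_le_eq)
    then have "R\<^sup>2 \<le> (r * sqrt (real d))\<^sup>2" using pos by (intro power_mono) auto
    then show ?thesis using r by (simp add: T_def power_mult_distrib divide_le_eq mult.commute)
  qed
  have l_eq: "l = ln (exp 1 * real d / T)" by (simp add: l_def T_def)
  have "1 \<le> l" unfolding l_eq using T1 Td by (subst ln_ge_iff) (auto simp: field_simps)
  then have D: "1 \<le> D" unfolding D_def using T1 mult_mono[of 1 T 1 l] by simp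
  have m1: "1 \<le> m" "T < real m + 1" using T1 unfolding m_def by linarith+
  then have m: "1 \<le> m" "T \<le> 2 * real m" by linarith+
  have Tr: "T * r\<^sup>2 = R\<^sup>2" using r by (simp add: T_def)
  have Rm: "R\<^sup>2 / real m \<le> 2 * r\<^sup>2"
    unfolding Tr[symmetric] using m mult_right_mono[OF m(2), of "r\<^sup>2"] by (simp add: divide_le_eq mult_ac)
  have card: "2 * real (card (compositions d m)) \<le> exp (4 * D)"
    using double_card_compositions_le_exp[OF T1 Td] by (simp add: m_def D_def l_eq)
  define \<gamma> where "\<gamma> = min (real n / b) (sqrt (D * real n / (L * r\<^sup>2)))"
  have n0: "0 < real n" "0 < D" "0 < r\<^sup>2" using n D r by auto
  note scale = optimal_scale[OF pos(3) n0(3) n0(2) pos(1) n0(1), folded \<gamma>_def]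
  have "(\<integral>\<^sup>+\<omega>. (SUP \<theta>\<in>{\<theta> \<in> prob_simplex d. quad_form d A \<theta> \<le> r\<^sup>2}.
                  ennreal (rademacher_process d n \<epsilon> Z h \<theta> \<omega>)) \<partial>M)
        \<le> ennreal (3 * r\<^sup>2 * \<gamma> * L / real n + 4 * D / \<gamma>)"
    by (rule expected_sup_le[OF n A pos(3) Z \<epsilon> ind h b diag var scale(1,2) m(1) Rm _ card]) (use D in simp)
  also have "\<dots> \<le> ennreal (7 * max (sqrt (L * r\<^sup>2 * D / real n)) (b * D / real n))"
    by (intro ennreal_leI scale(3))
  also have "sqrt (L * r\<^sup>2 * D / real n) = sqrt L * R * sqrt (l / real n)"
  proof -
    have "L * r\<^sup>2 * D / real n = L * R\<^sup>2 * (l / real n)" by (simp add: D_def Tr[symmetric] mult_ac)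
    then show ?thesis using pos by (simp only: real_sqrt_mult real_sqrt_abs abs_of_pos)
  qed
  also have "b * D / real n = b * R\<^sup>2 * l / (r\<^sup>2 * real n)" by (simp add: D_def T_def)
  finally show ?thesis unfolding l_def .
qed

(* The bound c <= 100 makes c absolute: HOL cannot quantify over the types 'w and 'z inside the
   existential, so without a numeric bound c could vary with these types. The inequality is
   monotone in c, so the theorem gives the single constant 100 at all types.
   The supremum is taken in ennreal, where it is 0 over the empty set, and its expectation is a
   nonnegative integral, so no finiteness or integrability convention enters. *)

theorem proposition10:
  shows "\<exists>c::real. c > 0 \<and> c \<le> 100 \<and>
    (\<forall>(M::nat) (n::nat) (b::real) (R::real) (L::real) (A :: nat \<Rightarrow> nat \<Rightarrow> real)
      (P :: 'w measure) (S :: 'z measure)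
      (Z :: nat \<Rightarrow> 'w \<Rightarrow> 'z) (\<epsilon> :: nat \<Rightarrow> 'w \<Rightarrow> real) (h :: nat \<Rightarrow> 'z \<Rightarrow> real).
      M \<ge> 2 \<longrightarrow> n \<ge> 1 \<longrightarrow> b > 0 \<longrightarrow> R > 0 \<longrightarrow> L > 0 \<longrightarrow>
      pos_semidef M A \<longrightarrow>
      prob_space P \<longrightarrow>
      iid P S n Z \<longrightarrow>
      iid P borel n \<epsilon> \<longrightarrow> (\<forall>i\<in>{1..n}. rademacher P (\<epsilon> i)) \<longrightarrow>
      indep_rv P (\<Pi>\<^sub>M i\<in>{1..n}. borel) (\<lambda>\<omega>. \<lambda>i\<in>{1..n}. \<epsilon> i \<omega>)
                 (\<Pi>\<^sub>M i\<in>{1..n}. S) (\<lambda>\<omega>. \<lambda>i\<in>{1..n}. Z i \<omega>) \<longrightarrow>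
      (\<forall>j\<in>{1..M}. h j \<in> borel_measurable S) \<longrightarrow>
      (\<forall>j\<in>{1..M}. AE \<omega> in P. \<bar>h j (Z 1 \<omega>)\<bar> \<le> b) \<longrightarrow>
      (\<forall>j\<in>{1..M}. A j j \<le> R\<^sup>2) \<longrightarrow>
      (\<forall>\<theta>\<in>prob_simplex M. (\<integral>\<omega>. (lin_comb M h \<theta> (Z 1 \<omega>))\<^sup>2 \<partial>P) \<le> L * quad_form M A \<theta>) \<longrightarrow>
      (\<forall>r::real. r > 0 \<longrightarrow> R / sqrt (real M) \<le> r \<longrightarrow> r \<le> R \<longrightarrow>
        (\<integral>\<^sup>+\<omega>. (SUP \<theta>\<in>{\<theta> \<in> prob_simplex M. quad_form M A \<theta> \<le> r\<^sup>2}.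
                  ennreal (rademacher_process M n \<epsilon> Z h \<theta> \<omega>)) \<partial>P)
        \<le> ennreal (c * max (sqrt L * R * sqrt (ln (exp 1 * real M * r\<^sup>2 / R\<^sup>2) / real n))
                           (b * R\<^sup>2 * ln (exp 1 * real M * r\<^sup>2 / R\<^sup>2) / (r\<^sup>2 * real n)))))"
proof (intro exI[of _ 7] conjI allI impI)
  fix M n :: nat and b R L :: real and A :: "nat \<Rightarrow> nat \<Rightarrow> real" and P :: "'w measure" and S :: "'z measure"
    and Z :: "nat \<Rightarrow> 'w \<Rightarrow> 'z" and \<epsilon> :: "nat \<Rightarrow> 'w \<Rightarrow> real" and h :: "nat \<Rightarrow> 'z \<Rightarrow> real" and r :: real
  assume "prob_space P" and M: "2 \<le> M"
  interpret prob_space P by fact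
  assume "1 \<le> n" "0 < b" "0 < R" "0 < L" "pos_semidef M A" "iid P S n Z" "iid P borel n \<epsilon>"
    "\<forall>i\<in>{1..n}. rademacher P (\<epsilon> i)"
    "indep_rv P (\<Pi>\<^sub>M i\<in>{1..n}. borel) (\<lambda>\<omega>. \<lambda>i\<in>{1..n}. \<epsilon> i \<omega>) (\<Pi>\<^sub>M i\<in>{1..n}. S) (\<lambda>\<omega>. \<lambda>i\<in>{1..n}. Z i \<omega>)"
    "\<forall>j\<in>{1..M}. h j \<in> borel_measurable S" "\<forall>j\<in>{1..M}. AE \<omega> in P. \<bar>h j (Z 1 \<omega>)\<bar> \<le> b"
    "\<forall>j\<in>{1..M}. A j j \<le> R\<^sup>2"
    "\<forall>\<theta>\<in>prob_simplex M. (\<integral>\<omega>. (lin_comb M h \<theta> (Z 1 \<omega>))\<^sup>2 \<partial>P) \<le> L * quad_form M A \<theta>"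
    "0 < r" "R / sqrt (real M) \<le> r" "r \<le> R"
  then show "(\<integral>\<^sup>+\<omega>. (SUP \<theta>\<in>{\<theta> \<in> prob_simplex M. quad_form M A \<theta> \<le> r\<^sup>2}.
                  ennreal (rademacher_process M n \<epsilon> Z h \<theta> \<omega>)) \<partial>P)
        \<le> ennreal (7 * max (sqrt L * R * sqrt (ln (exp 1 * real M * r\<^sup>2 / R\<^sup>2) / real n))
                           (b * R\<^sup>2 * ln (exp 1 * real M * r\<^sup>2 / R\<^sup>2) / (r\<^sup>2 * real n)))"
    using M by (intro expected_localized_sup_le) auto
qed simp_all


end
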